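(* Let $n,k,r,\delta$ be integers with $\delta>2$ and $k>r\ge 1$. There exists an optimal quaternary $[n,k,d]$ $(r,\delta)$-LRC code with minimum distance $d=3$ if and only if $\delta=3$ and there is an integer $l\ge 2$ such that one of the following holds: (1) $r=3$, $n=5l-1$, $k=3l-1$; (2) $r=2$, $n=4l-1$, $k=2l-1$; (3) $r=3$, $n=5l-2$, $k=3l-2$; (4) $1\le r\le 3$, $n=l(r+2)$, $k=rl$.
   Context: Quaternary means over $\mathbb{F}_4$. For a linear code $\mathcal C\subseteq\mathbb{F}_q^n$ and $R\subseteq[n]=\{1,\dots,n\}$, $\mathcal C|_R$ is the code obtained by puncturing (deleting) the coordinates outside $R$. An $[n,k,d]$ linear code $\mathcal C$ is an $(r,\delta)$-LRC code if for every $i\in[n]$ there is $R_i\subseteq[n]$ with $i\in R_i$, $|R_i|\le r+\delta-1$, such that $\mathcal C|_{R_i}$ has minimum distance at least $\delta$ (every nonzero word has weight at least $\delta$). Every such code satisfies $d\le n-k+1-(\lceil k/r\rceil-1)(\delta-1)$; it is $d$-optimal if equality holds. An $(r,\delta)$-LRC code is $r$-optimal if it is not an $(r',\delta)$-LRC code for any $1\le r'<r$. "Optimal $(r,\delta)$-LRC code" means an $(r,\delta)$-LRC code that is both $d$-optimal and $r$-optimal, with $d\ge\delta>2$ and $k>r\ge1$. *)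

theory Defs
  imports Complex_Main "HOL-Library.Function_Algebras" "HOL-Library.Extended_Nat" "HOL-Library.Cardinality"
begin

text \<open>
  A word with coordinates in \<open>I\<close> (an element of \<open>F\<^sup>I\<close>) is a function \<open>nat \<Rightarrow> 'a\<close> vanishing
  outside \<open>I\<close>; addition and zero are the pointwise ones of \<^theory>\<open>HOL-Library.Function_Algebras\<close>.
\<close>

definition words :: "nat set \<Rightarrow> (nat \<Rightarrow> 'a::zero) set" where
  "words I = {x. \<forall>i. i \<notin> I \<longrightarrow> x i = 0}"

definition word_scale :: "'a::field \<Rightarrow> (nat \<Rightarrow> 'a) \<Rightarrow> nat \<Rightarrow> 'a" where
  "word_scale c x = (\<lambda>i. c * x i)"

interpretation word: vector_space "word_scale :: 'a::field \<Rightarrow> (nat \<Rightarrow> 'a) \<Rightarrow> nat \<Rightarrow> 'a"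
  by unfold_locales (auto simp: word_scale_def fun_eq_iff algebra_simps)

definition weight :: "(nat \<Rightarrow> 'a::zero) \<Rightarrow> nat" where
  "weight x = card {i. x i \<noteq> 0}"

text \<open>
  The value is infinite for the zero code, so that \<open>enat \<delta> \<le> min_distance C\<close> says exactly that
  every nonzero word of \<open>C\<close> has weight at least \<open>\<delta>\<close>. All codes considered are linear.
\<close>

definition min_distance :: "(nat \<Rightarrow> 'a::zero) set \<Rightarrow> enat" where
  "min_distance C = (INF x\<in>C - {0}. enat (weight x))"

definition linear_code :: "nat \<Rightarrow> nat \<Rightarrow> nat \<Rightarrow> (nat \<Rightarrow> 'a::{field,finite}) set \<Rightarrow> bool" where
  "linear_code n k d C \<longleftrightarrow>
     C \<subseteq> words {1..n} \<and> word.subspace C \<and> word.dim C = k \<and> min_distance C = enat d"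

text \<open>Deleting the coordinates outside \<open>R\<close> yields a code in \<open>words R\<close>.\<close>

definition puncture :: "(nat \<Rightarrow> 'a::zero) set \<Rightarrow> nat set \<Rightarrow> (nat \<Rightarrow> 'a) set" where
  "puncture C R = (\<lambda>x i. if i \<in> R then x i else 0) ` C"

definition is_LRC :: "nat \<Rightarrow> nat \<Rightarrow> nat \<Rightarrow> (nat \<Rightarrow> 'a::zero) set \<Rightarrow> bool" where
  "is_LRC n r \<delta> C \<longleftrightarrow>
     (\<forall>i\<in>{1..n}. \<exists>R\<subseteq>{1..n}. i \<in> R \<and> card R \<le> r + \<delta> - 1 \<and>
        enat \<delta> \<le> min_distance (puncture C R))"

definition d_optimal :: "nat \<Rightarrow> nat \<Rightarrow> nat \<Rightarrow> nat \<Rightarrow> nat \<Rightarrow> bool" where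
  "d_optimal n k d r \<delta> \<longleftrightarrow>
     int d = int n - int k + 1 - (\<lceil>real k / real r\<rceil> - 1) * (int \<delta> - 1)"

definition r_optimal :: "nat \<Rightarrow> nat \<Rightarrow> nat \<Rightarrow> (nat \<Rightarrow> 'a::zero) set \<Rightarrow> bool" where
  "r_optimal n r \<delta> C \<longleftrightarrow> (\<forall>r'. 1 \<le> r' \<and> r' < r \<longrightarrow> \<not> is_LRC n r' \<delta> C)"

definition optimal_LRC ::
    "nat \<Rightarrow> nat \<Rightarrow> nat \<Rightarrow> nat \<Rightarrow> nat \<Rightarrow> (nat \<Rightarrow> 'a::{field,finite}) set \<Rightarrow> bool" where
  "optimal_LRC n k d r \<delta> C \<longleftrightarrow>
     linear_code n k d C \<and> is_LRC n r \<delta> C \<and> d_optimal n k d r \<delta> \<and> r_optimal n r \<delta> C \<and>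
     d \<ge> \<delta> \<and> \<delta> > 2 \<and> k > r \<and> r \<ge> 1"

end

theory Submission
  imports Defs "HOL-Library.FuncSet"
begin

text \<open>
  With \<open>d = \<delta> = 3\<close>, optimality means \<open>n - k = 2 l\<close> for \<open>l = \<lceil>k / r\<rceil>\<close>, so \<open>n = l (r + 2) - t\<close> and
  \<open>k = l r - t\<close> with \<open>t < r\<close>, and only \<open>r < q\<close> remains to be shown. Covering the coordinates
  greedily by repair sets uses up the redundancy \<open>2 l\<close> exactly, so each repair set carries an MDS
  code of distance 3, whose length is at most \<open>q + 1\<close>; for \<open>r \<ge> q\<close> this contradicts
  \<open>r\<close>-optimality. Conversely, a direct sum of \<open>l\<close> MDS codes of distance 3, the last one
  shortened by \<open>t\<close> coordinates, is optimal: a repair set missing a coordinate of a full block is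
  defeated by a word of weight 3 in that block.
\<close>

section \<open>Counting words in subspaces and punctured codes\<close>

text \<open>Coefficient vectors over a basis, taken as extensional functions, biject with the
  subspace. This turns ranks into cardinalities, so that later rank arguments become injections
  between finite sets.\<close>

lemma (in vector_space) card_subspace:
  assumes "subspace S" "finite S" "finite (UNIV :: 'a set)"
  shows "card S = CARD('a) ^ dim S"
proof -
  obtain B where B: "B \<subseteq> S" "independent B" "S \<subseteq> span B" "card B = dim S"
    using basis_exists by blast
  have finB: "finite B"
    using B(1) assms(2) finite_subset by blast
  have S: "S = span B"
    using B(1,3) assms(1) span_minimal by blast
  let ?f = "\<lambda>u. \<Sum>v\<in>B. u v *s v"
  have "inj_on ?f (B \<rightarrow>\<^sub>E UNIV)"
  proof (rule inj_onI)
    fix u u' assume u: "u \<in> B \<rightarrow>\<^sub>E UNIV" and u': "u' \<in> B \<rightarrow>\<^sub>E UNIV" and eq: "?f u = ?f u'"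
    have "(\<Sum>v\<in>B. (u v - u' v) *s v) = 0"
      using eq by (simp add: scale_left_diff_distrib sum_subtractf)
    then have "u v - u' v = 0" if "v \<in> B" for v
      using independentD[OF B(2) finB subset_refl, of "\<lambda>v. u v - u' v"] that by blast
    then show "u = u'"
      using u u' by (intro PiE_ext) auto
  qed
  moreover have "?f ` (B \<rightarrow>\<^sub>E UNIV) = span B"
  proof -
    have "?f u \<in> ?f ` (B \<rightarrow>\<^sub>E UNIV)" for u
      by (rule image_eqI[of _ _ "restrict u B"]) (auto intro!: sum.cong)
    then show ?thesis
      unfolding span_finite[OF finB] by blast
  qed
  ultimately have "bij_betw ?f (B \<rightarrow>\<^sub>E UNIV) S"
    unfolding S bij_betw_def by blast
  then have "card S = card (B \<rightarrow>\<^sub>E (UNIV :: 'a set))"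
    by (simp add: bij_betw_same_card)
  then show ?thesis
    using finB B(4) by (simp add: card_PiE)
qed

lemma finite_words_card_words:
  fixes I :: "nat set"
  assumes "finite I"
  shows finite_words: "finite (words I :: (nat \<Rightarrow> 'a::{zero,finite}) set)"
    and card_words: "card (words I :: (nat \<Rightarrow> 'a) set) = CARD('a) ^ card I"
proof -
  have bij: "bij_betw (\<lambda>x. restrict x I) (words I :: (nat \<Rightarrow> 'a) set) (I \<rightarrow>\<^sub>E UNIV)"
    by (rule bij_betw_byWitness[where f' = "\<lambda>x i. if i \<in> I then x i else 0"])
       (auto simp: words_def fun_eq_iff PiE_def extensional_def)
  show "finite (words I :: (nat \<Rightarrow> 'a) set)"
    using bij_betw_finite[OF bij] assms by (simp add: finite_PiE)
  show "card (words I :: (nat \<Rightarrow> 'a) set) = CARD('a) ^ card I"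
    using bij_betw_same_card[OF bij] assms by (simp add: card_PiE)
qed

lemma enat_le_min_distance:
  "enat d \<le> min_distance C \<longleftrightarrow> (\<forall>x\<in>C. x \<noteq> 0 \<longrightarrow> d \<le> weight x)"
  by (auto simp: min_distance_def le_INF_iff)

lemma puncture_subset_words: "puncture C R \<subseteq> words R"
  by (auto simp: puncture_def words_def)

lemma puncture_eq_self: "C \<subseteq> words I \<Longrightarrow> puncture C I = C"
proof -
  assume C: "C \<subseteq> words I"
  have "(\<lambda>i. if i \<in> I then x i else 0) = x" if "x \<in> C" for x
    using C that by (auto simp: words_def fun_eq_iff)
  then show ?thesis
    by (simp add: puncture_def)
qed

lemma finite_puncture: "finite R \<Longrightarrow> finite (puncture (C :: (nat \<Rightarrow> 'a::{zero,finite}) set) R)"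
  using finite_subset[OF puncture_subset_words finite_words] .

lemma subspace_puncture:
  assumes "word.subspace C"
  shows "word.subspace (puncture C R)"
proof (rule word.subspaceI)
  show "0 \<in> puncture C R"
    using word.subspace_0[OF assms] unfolding puncture_def
    by (auto intro!: image_eqI[of _ _ 0])
next
  fix x y assume "x \<in> puncture C R" "y \<in> puncture C R"
  then obtain x' y' where "x' \<in> C" "y' \<in> C"
    "x = (\<lambda>i. if i \<in> R then x' i else 0)" "y = (\<lambda>i. if i \<in> R then y' i else 0)"
    unfolding puncture_def by blast
  then show "x + y \<in> puncture C R"
    using word.subspace_add[OF assms, of x' y'] unfolding puncture_def
    by (auto intro!: image_eqI[of _ _ "x' + y'"])
next
  fix c x assume "x \<in> puncture C R"
  then obtain x' where "x' \<in> C" "x = (\<lambda>i. if i \<in> R then x' i else 0)"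
    unfolding puncture_def by blast
  then show "word_scale c x \<in> puncture C R"
    using word.subspace_scale[OF assms, of x' c] unfolding puncture_def
    by (auto intro!: image_eqI[of _ _ "word_scale c x'"] simp: word_scale_def)
qed

section \<open>The greedy covering bound\<close>

text \<open>Two codewords that agree on \<open>U\<close> and on \<open>R - U - T\<close> differ
  within \<open>R\<close> only on \<open>T\<close>, in fewer than \<open>\<delta>\<close> places, so
  they agree on \<open>R\<close>. Up to \<open>card T\<close> of the new coordinates thus come for
  free.\<close>

lemma card_puncture_Un_le:
  fixes C :: "(nat \<Rightarrow> 'a::{field,finite}) set"
  assumes C: "word.subspace C" and fin: "finite U" "finite R"
    and dist: "enat \<delta> \<le> min_distance (puncture C R)"
    and T: "T \<subseteq> R - U" "card T < \<delta>"
  shows "card (puncture C (U \<union> R)) \<le> card (puncture C U) * CARD('a) ^ card (R - U - T)"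
proof -
  define J where "J = R - U - T"
  let ?\<pi> = "\<lambda>S x i. if i \<in> S then x i else (0::'a)"
  let ?f = "\<lambda>x. (?\<pi> U x, ?\<pi> J x)"
  have "inj_on ?f (puncture C (U \<union> R))"
  proof (rule inj_onI)
    fix x y assume "x \<in> puncture C (U \<union> R)" "y \<in> puncture C (U \<union> R)" and eq: "?f x = ?f y"
    then obtain x' y' where x': "x' \<in> C" "x = ?\<pi> (U \<union> R) x'" and y': "y' \<in> C" "y = ?\<pi> (U \<union> R) y'"
      unfolding puncture_def by blast
    let ?z = "?\<pi> R (x' - y')"
    have agree: "x' i = y' i" if "i \<in> U \<or> i \<in> J" for i
    proof -
      have "?\<pi> U x = ?\<pi> U y" "?\<pi> J x = ?\<pi> J y"
        using eq by simp_all
      from this[THEN fun_cong, of i] show ?thesis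
        using that unfolding x'(2) y'(2) by (auto simp: J_def split: if_splits)
    qed
    have "{i. ?z i \<noteq> 0} \<subseteq> T"
      using agree by (auto simp: J_def split: if_splits)
    moreover have "finite T"
      using T(1) fin(2) finite_subset by blast
    ultimately have "weight ?z < \<delta>"
      unfolding weight_def using T(2) card_mono le_less_trans by blast
    moreover have "?z \<in> puncture C R"
      using word.subspace_diff[OF C x'(1) y'(1)] unfolding puncture_def by blast
    ultimately have "?z = 0"
      using dist unfolding enat_le_min_distance by (meson not_le)
    then have "x' i = y' i" if "i \<in> R" for i
      using that fun_cong[of ?z 0 i] by simp
    then show "x = y"
      using agree x'(2) y'(2) by auto
  qed
  moreover have "?f ` puncture C (U \<union> R) \<subseteq> puncture C U \<times> words J"
  proof -
    have "?\<pi> U x \<in> puncture C U" if "x \<in> puncture C (U \<union> R)" for x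
    proof -
      obtain x' where x': "x' \<in> C" "x = ?\<pi> (U \<union> R) x'"
        using \<open>x \<in> puncture C (U \<union> R)\<close> unfolding puncture_def by blast
      then have "?\<pi> U x = ?\<pi> U x'"
        by auto
      then show ?thesis
        using x'(1) unfolding puncture_def by blast
    qed
    then show ?thesis
      by (auto simp: words_def)
  qed
  moreover have "finite (puncture C U \<times> (words J :: (nat \<Rightarrow> 'a) set))"
    using fin by (simp add: J_def finite_puncture finite_words)
  ultimately have "card (puncture C (U \<union> R)) \<le> card (puncture C U \<times> (words J :: (nat \<Rightarrow> 'a) set))"
    using card_inj_on_le by blast
  then show ?thesis
    using fin by (simp add: J_def card_words card_cartesian_product)
qed

text \<open>
  The greedy covering argument behind the Singleton-like bound, run from an arbitrary initial set
  \<open>U\<close>. Here \<open>s\<close> counts the repair sets that contribute at least \<open>\<delta> - 1\<close> new coordinates, and \<open>e\<close>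
  is a surplus of redundancy that the initial set may already have.
\<close>

lemma LRC_covering:
  fixes C :: "(nat \<Rightarrow> 'a::{field,finite}) set"
  assumes C: "word.subspace C" "C \<subseteq> words {1..n}" and LRC: "is_LRC n r \<delta> C" and \<delta>: "\<delta> \<ge> 1"
    and "U \<subseteq> {1..n}" "card (puncture C U) \<le> CARD('a) ^ (r * s)"
    and "card (puncture C U) * CARD('a) ^ ((\<delta> - 1) * s + e) \<le> CARD('a) ^ card U"
  shows "\<exists>s. card C \<le> CARD('a) ^ (r * s) \<and> card C * CARD('a) ^ ((\<delta> - 1) * s + e) \<le> CARD('a) ^ n"
  using assms(5-)
\<comment> \<open>The invariants say that \<open>U\<close> has rank at most \<open>r * s\<close> and
  redundancy at least \<open>(\<delta> - 1) * s + e\<close>. They are phrased with powers of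
  \<open>q\<close> and a product, which avoids logarithms and subtraction.\<close>
proof (induction "n - card U" arbitrary: U s rule: less_induct)
  case less
  let ?q = "CARD('a)"
  have q: "?q \<ge> 1"
    by (simp add: Suc_leI)
  show ?case
  proof (cases "U = {1..n}")
    case True
    then show ?thesis
      using less.prems puncture_eq_self[OF C(2)] by auto
  next
    case False
    then obtain i where i: "i \<in> {1..n}" "i \<notin> U"
      using less.prems(1) by blast
    then obtain R where R: "R \<subseteq> {1..n}" "i \<in> R" "card R \<le> r + \<delta> - 1"
      "enat \<delta> \<le> min_distance (puncture C R)"
      using LRC unfolding is_LRC_def by meson
    have fin: "finite U" "finite R"
      using R(1) less.prems(1) finite_subset by blast+
    have cardUR: "card (U \<union> R) = card U + card (R - U)"
      using card_Un_disjoint[of U "R - U"] fin by simp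
    have "card (R - U) \<noteq> 0"
      using i R(2) fin by auto
    moreover have "card (U \<union> R) \<le> card {1..n}"
      using less.prems(1) R(1) by (intro card_mono) auto
    ultimately have decr: "n - card (U \<union> R) < n - card U"
      using cardUR by simp
    have sub: "U \<union> R \<subseteq> {1..n}"
      using less.prems(1) R(1) by simp
    let ?N = "card (puncture C U)" and ?N' = "card (puncture C (U \<union> R))"
    show ?thesis
    proof (cases "\<delta> - 1 \<le> card (R - U)")
      case True
      \<comment> \<open>\<open>R\<close> brings \<open>\<delta> - 1\<close> determined coordinates
        and \<open>a \<le> r\<close> others, so \<open>s\<close> grows by one and both invariants
        persist.\<close>
      then obtain T where T: "T \<subseteq> R - U" "card T = \<delta> - 1"
        using obtain_subset_with_card_n by meson
      define a where "a = card (R - U - T)"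
      have a: "card (R - U) = a + (\<delta> - 1)"
        using T True fin by (simp add: a_def card_Diff_subset finite_subset)
      have "card (R - U) \<le> r + \<delta> - 1"
        using R(3) card_mono[of R "R - U"] fin by force
      then have "a \<le> r"
        using a \<delta> by simp
      have le: "?N' \<le> ?N * ?q ^ a"
        unfolding a_def by (rule card_puncture_Un_le[OF C(1) fin R(4) T(1)]) (use T(2) \<delta> in simp)
      have "?N' \<le> ?q ^ (r * s) * ?q ^ r"
        using le mult_le_mono[OF less.prems(2) power_increasing[OF \<open>a \<le> r\<close> q]] by linarith
      then have 1: "?N' \<le> ?q ^ (r * Suc s)"
        by (simp add: power_add mult.commute)
      have "?N' * ?q ^ ((\<delta> - 1) * Suc s + e) \<le> ?N * ?q ^ a * ?q ^ ((\<delta> - 1) * Suc s + e)"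
        using le by simp
      also have "\<dots> = ?N * ?q ^ ((\<delta> - 1) * s + e) * ?q ^ card (R - U)"
        by (simp add: a power_add mult_ac)
      also have "\<dots> \<le> ?q ^ card U * ?q ^ card (R - U)"
        using less.prems(3) by simp
      finally have 2: "?N' * ?q ^ ((\<delta> - 1) * Suc s + e) \<le> ?q ^ card (U \<union> R)"
        by (simp add: cardUR power_add)
      show ?thesis
        by (rule less.hyps[OF decr sub 1 2])
    next
      case False
      \<comment> \<open>With \<open>T = R - U\<close> all new coordinates are determined by
        \<open>U\<close>: the rank does not grow, the length does, and \<open>s\<close>
        stays.\<close>
      have le: "?N' \<le> ?N"
        using card_puncture_Un_le[OF C(1) fin R(4) subset_refl] False by simp
      have 1: "?N' \<le> ?q ^ (r * s)"
        using le less.prems(2) by simp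
      have "?N' * ?q ^ ((\<delta> - 1) * s + e) \<le> ?q ^ card U"
        using le less.prems(3) mult_le_mono1 order_trans by blast
      also have "\<dots> \<le> ?q ^ card (U \<union> R)"
        using q by (intro power_increasing) (simp add: cardUR)
      finally have 2: "?N' * ?q ^ ((\<delta> - 1) * s + e) \<le> ?q ^ card (U \<union> R)" .
      show ?thesis
        by (rule less.hyps[OF decr sub 1 2])
    qed
  qed
qed

section \<open>Necessity: sphere packing, d-optimal parameters, locality below the field
  size\<close>

text \<open>Sphere packing: balls of radius 1 about codewords are disjoint, because codewords
  differing in at most two places coincide. For redundancy 2 this limits the length to
  \<open>q + 1\<close>.\<close>

lemma hamming_bound_distance_3:
  fixes C :: "(nat \<Rightarrow> 'a::{field,finite}) set"
  assumes C: "word.subspace C" "C \<subseteq> words R" and R: "finite R" and dist: "enat 3 \<le> min_distance C"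
  shows "card C * (1 + card R * (CARD('a) - 1)) \<le> CARD('a) ^ card R"
proof -
  \<comment> \<open>\<open>E\<close> is the ball of radius 1 about 0: the zero word and all words
    with a single nonzero entry in \<open>R\<close>.\<close>
  let ?e = "\<lambda>(i, a) j. if j = i then a else (0::'a)"
  define E where "E = insert 0 (?e ` (R \<times> (UNIV - {0})))"
  have E: "E \<subseteq> words R" "finite E"
    using R by (auto simp: E_def words_def)
  have supp: "\<exists>i. {j. y j \<noteq> 0} \<subseteq> {i}" if "y \<in> E" for y
    using that by (fastforce simp: E_def split: if_splits)
  have "inj_on ?e (R \<times> (UNIV - {0}))"
    by (auto intro!: inj_onI simp: fun_eq_iff) (metis+)
  then have "card (?e ` (R \<times> (UNIV - {0}))) = card R * (CARD('a) - 1)"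
    by (simp add: card_image card_cartesian_product)
  moreover have "0 \<notin> ?e ` (R \<times> (UNIV - {0}))"
    by (auto simp: fun_eq_iff) metis
  ultimately have cardE: "card E = 1 + card R * (CARD('a) - 1)"
    using R by (simp add: E_def)
  let ?f = "\<lambda>(x, y). x + y"
  have "inj_on ?f (C \<times> E)"
  proof (rule inj_onI, clarify)
    fix x y x' y' assume x: "x \<in> C" "x' \<in> C" and y: "y \<in> E" "y' \<in> E" and eq: "x + y = x' + y'"
    obtain i i' where i: "{j. y j \<noteq> 0} \<subseteq> {i}" "{j. y' j \<noteq> 0} \<subseteq> {i'}"
      using supp y by meson
    have diff: "x - x' = y' - y"
      using eq by (simp add: algebra_simps)
    have "{j. (x - x') j \<noteq> 0} \<subseteq> {i, i'}"
    proof
      fix j assume "j \<in> {j. (x - x') j \<noteq> 0}"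
      then have "y j \<noteq> 0 \<or> y' j \<noteq> 0"
        unfolding diff by auto
      then show "j \<in> {i, i'}"
        using i by blast
    qed
    then have "weight (x - x') \<le> card {i, i'}"
      unfolding weight_def by (intro card_mono) auto
    also have "\<dots> < 3"
      by (simp add: card_insert_if)
    finally have "x - x' = 0"
      using dist word.subspace_diff[OF C(1) x] unfolding enat_le_min_distance by (meson not_le)
    then show "x = x' \<and> y = y'"
      using diff by simp
  qed
  moreover have "?f ` (C \<times> E) \<subseteq> words R"
  proof -
    have "x + y \<in> words R" if "x \<in> words R" "y \<in> words R" for x y :: "nat \<Rightarrow> 'a"
      using that by (simp add: words_def)
    then show ?thesis
      using C(2) E(1) by auto
  qed
  ultimately have "card (C \<times> E) \<le> card (words R :: (nat \<Rightarrow> 'a) set)"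
    using card_inj_on_le finite_words[OF R] by blast
  then show ?thesis
    by (simp add: card_cartesian_product cardE card_words R)
qed

text \<open>The covering bound read in exponents: \<open>card C\<close> is \<open>q ^ k\<close>, and
  powers of \<open>q > 1\<close> compare as their exponents do.\<close>

lemma LRC_card_bounds:
  fixes C :: "(nat \<Rightarrow> 'a::{field,finite}) set"
  assumes "linear_code n k d C" "is_LRC n r \<delta> C" "\<delta> \<ge> 1" "U \<subseteq> {1..n}"
    and "card (puncture C U) \<le> CARD('a) ^ (r * s)"
    and "card (puncture C U) * CARD('a) ^ ((\<delta> - 1) * s + e) \<le> CARD('a) ^ card U"
  shows "\<exists>s. k \<le> r * s \<and> k + (\<delta> - 1) * s + e \<le> n"
proof -
  have C: "word.subspace C" "C \<subseteq> words {1..n}" "word.dim C = k"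
    using assms(1) by (auto simp: linear_code_def)
  have "finite C"
    using C(2) finite_subset finite_words[of "{1..n}"] by blast
  then have "card C = CARD('a) ^ k"
    using word.card_subspace[OF C(1)] C(3) by simp
  moreover have "CARD('a) > 1"
    using card_mono[of UNIV "{0, 1 :: 'a}"] by simp
  ultimately show ?thesis
    using LRC_covering[OF C(1,2) assms(2-6)]
    by (simp add: power_add[symmetric] power_increasing_iff add.assoc)
qed

lemma ceiling_divide_le:
  assumes "k \<le> r * s" "r \<ge> 1"
  shows "\<lceil>real k / real r\<rceil> \<le> int s"
proof -
  have "real k \<le> real r * real s"
    using assms(1) by (metis of_nat_le_iff of_nat_mult)
  then have "real k / real r \<le> real s"
    using assms(2) by (simp add: divide_le_eq mult.commute)
  then show ?thesis
    by (simp add: ceiling_le_iff)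
qed

text \<open>Equality in the bound reads \<open>n = k + 2 * l\<close> with \<open>l\<close> the
  ceiling of \<open>k / r\<close>; \<open>t\<close> is what \<open>k\<close> lacks to the multiple
  \<open>l * r\<close>, and \<open>k > r\<close> forces \<open>l \<ge> 2\<close>.\<close>

lemma d_optimal_3_3_iff:
  assumes "r \<ge> 1" "k > r"
  shows "d_optimal n k 3 r 3 \<longleftrightarrow> (\<exists>l t. l \<ge> 2 \<and> t < r \<and> n = l * (r + 2) - t \<and> k = l * r - t)"
    (is "?L \<longleftrightarrow> ?R")
proof
  assume ?L
  define l where "l = nat \<lceil>real k / real r\<rceil>"
  have pos: "real k / real r > 1"
    using assms by simp
  then have l: "int l = \<lceil>real k / real r\<rceil>"
    unfolding l_def by linarith
  have n: "n = k + 2 * l"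
    using \<open>?L\<close> unfolding d_optimal_def l[symmetric] by auto
  have "l \<ge> 2"
    using pos l by linarith
  have "real k / real r \<le> real l" "real l - 1 < real k / real r"
    using l by linarith+
  then have "real k \<le> real l * real r" "(real l - 1) * real r < real k"
    using assms(1) by (simp_all add: pos_divide_le_eq pos_less_divide_eq)
  then have "real k \<le> real (l * r)" "real (l * r) < real (k + r)"
    by (simp_all add: algebra_simps)
  then have "k \<le> l * r" "l * r < k + r"
    unfolding of_nat_le_iff of_nat_less_iff .
  then have "l * r - k < r \<and> n = l * (r + 2) - (l * r - k) \<and> k = l * r - (l * r - k)"
    using n by (simp add: algebra_simps)
  then show ?R
    using \<open>l \<ge> 2\<close> by blast
next
  assume ?R
  then obtain l t where lt: "l \<ge> 2" "t < r" "n = l * (r + 2) - t" "k = l * r - t"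
    by blast
  \<comment> \<open>Hence the differences on naturals defining \<open>n\<close> and \<open>k\<close>
    do not truncate.\<close>
  have "t \<le> l * r"
    using lt(1,2) mult_le_mono1[of 1 l r] by linarith
  then have k: "k + t = l * r" "n = k + 2 * l"
    using lt by (simp_all add: algebra_simps)
  have "real k + real t = real l * real r"
    using k(1) by (metis of_nat_add of_nat_mult)
  then have "real k \<le> real l * real r" "(real l - 1) * real r < real k"
    using lt(2) by (simp_all add: algebra_simps)
  then have "real k / real r \<le> real l" "real l - 1 < real k / real r"
    using assms(1) by (simp_all add: pos_divide_le_eq pos_less_divide_eq)
  then have "\<lceil>real k / real r\<rceil> = int l"
    by linarith
  then show ?L
    using k(2) by (simp add: d_optimal_def)
qed

text \<open>
  A repair set of redundancy more than 2 would start a covering whose total redundancy exceeds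
  \<open>n - k\<close>.
\<close>

lemma optimal_LRC_3_imp_small_locality:
  fixes C :: "(nat \<Rightarrow> 'a::{field,finite}) set"
  assumes opt: "optimal_LRC n k 3 r 3 C" and q: "CARD('a) > 2"
  shows "r < CARD('a)"
proof (rule ccontr)
  assume "\<not> r < CARD('a)"
  let ?q = "CARD('a)"
  have lin: "linear_code n k 3 C" and LRC: "is_LRC n r 3 C" and dopt: "d_optimal n k 3 r 3"
    and ropt: "r_optimal n r 3 C" and r: "r \<ge> 1" and k: "k > r"
    using opt by (auto simp: optimal_LRC_def)
  have C: "word.subspace C"
    using lin by (simp add: linear_code_def)
  \<comment> \<open>A size of at most \<open>q + 1\<close> is what locality \<open>q - 1\<close>
    allows; as \<open>q - 1 < r\<close>, this will contradict r-optimality.\<close>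
  have "card R \<le> ?q + 1" if R: "R \<subseteq> {1..n}" "card R \<le> r + 2" "enat 3 \<le> min_distance (puncture C R)" for R
  proof -
    have finR: "finite R"
      using R(1) finite_subset by blast
    define \<rho> where "\<rho> = word.dim (puncture C R)"
    have N: "card (puncture C R) = ?q ^ \<rho>"
      unfolding \<rho>_def using word.card_subspace[OF subspace_puncture[OF C] finite_puncture[OF finR]] by simp
    have "card R < \<rho> + 3"
    proof (rule ccontr)
      assume "\<not> card R < \<rho> + 3"
      then have "\<rho> + 3 \<le> card R" "\<rho> \<le> r"
        using R(2) by auto
      \<comment> \<open>The covering starts from \<open>U = R\<close> with \<open>s = 1\<close>;
        redundancy 3 is the 2 expected from one repair set plus a surplus \<open>e = 1\<close>, one
        more than \<open>n - k\<close> can hold.\<close>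
      then have "?q ^ \<rho> \<le> ?q ^ (r * 1)" "?q ^ (\<rho> + ((3 - 1) * 1 + 1)) \<le> ?q ^ card R"
        using q by (intro power_increasing; simp)+
      then have "\<exists>s. k \<le> r * s \<and> k + (3 - 1) * s + 1 \<le> n"
        by (intro LRC_card_bounds[OF lin LRC _ R(1), of 1 1]) (simp_all only: N power_add one_le_numeral)
      then obtain s where s: "k \<le> r * s" "k + 2 * s + 1 \<le> n"
        by auto
      then show False
        using ceiling_divide_le[OF s(1) r] dopt by (simp add: d_optimal_def)
    qed
    then have le: "?q ^ card R \<le> ?q ^ (\<rho> + 2)"
      by (intro power_increasing) auto
    have "?q ^ \<rho> * (1 + card R * (?q - 1)) \<le> ?q ^ card R"
      using hamming_bound_distance_3[OF subspace_puncture[OF C] puncture_subset_words finR R(3)] N by simp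
    also note le
    \<comment> \<open>Since \<open>1 + (q + 1) * (q - 1)\<close> is the square of \<open>q\<close>,
      the sphere packing bound can be cancelled down to the length.\<close>
    also have "?q ^ (\<rho> + 2) = ?q ^ \<rho> * (1 + (?q + 1) * (?q - 1))"
      using q by (simp add: power_add power2_eq_square algebra_simps)
    finally have "1 + card R * (?q - 1) \<le> 1 + (?q + 1) * (?q - 1)"
      by (rule mult_left_le_imp_le) (use q in simp)
    then have "card R * (?q - 1) \<le> (?q + 1) * (?q - 1)"
      unfolding add_le_cancel_left .
    then show ?thesis
      by (rule mult_right_le_imp_le) (use q in simp)
  qed
  moreover have "r + 3 - 1 = r + 2" "?q - 1 + 3 - 1 = ?q + 1"
    using q by simp_all
  ultimately have "is_LRC n (?q - 1) 3 C"
    using LRC unfolding is_LRC_def by metis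
  moreover have "1 \<le> ?q - 1" "?q - 1 < r"
    using q \<open>\<not> r < ?q\<close> by auto
  ultimately show False
    using ropt unfolding r_optimal_def by blast
qed

section \<open>The block code: parity checks and local distance\<close>

text \<open>
  The columns \<open>(chk0 p, chk1 w p)\<close> for \<open>p < m\<close> are distinct points of the projective line:
  \<open>(1, 0)\<close>, \<open>(0, 1)\<close> and \<open>(1, w p)\<close> for distinct nonzero \<open>w p\<close>. They are the columns of a
  parity check matrix of an MDS code of length \<open>m\<close>, whose systematic form has the check symbols at
  positions 0 and 1.
\<close>

definition chk0 :: "nat \<Rightarrow> 'a::field" where
  "chk0 p = (if p = 1 then 0 else 1)"

definition chk1 :: "(nat \<Rightarrow> 'a) \<Rightarrow> nat \<Rightarrow> 'a::field" where
  "chk1 w p = (if p = 0 then 0 else if p = 1 then 1 else w p)"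

definition chk_det :: "(nat \<Rightarrow> 'a) \<Rightarrow> nat \<Rightarrow> nat \<Rightarrow> 'a::field" where
  "chk_det w p p' = chk0 p * chk1 w p' - chk0 p' * chk1 w p"

text \<open>
  The direct sum of copies of this MDS code, the block \<open>b\<close> having the coordinates
  \<open>b * m + 1, \<dots>, b * m + m\<close>, cut off after coordinate \<open>n\<close> by setting the remaining symbols to 0.
\<close>

definition block_code :: "(nat \<Rightarrow> 'a::field) \<Rightarrow> nat \<Rightarrow> nat \<Rightarrow> (nat \<Rightarrow> 'a) set" where
  "block_code w m n = {x \<in> words {1..n}. \<forall>b.
     (\<Sum>p<m. chk0 p * x (Suc (b * m + p))) = 0 \<and> (\<Sum>p<m. chk1 w p * x (Suc (b * m + p))) = 0}"

text \<open>Indices start at 2 because the columns at positions 0 and 1 are the fixed unit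
  vectors.\<close>

definition distinct_nonzero :: "(nat \<Rightarrow> 'a::zero) \<Rightarrow> nat \<Rightarrow> bool" where
  "distinct_nonzero w m \<longleftrightarrow> inj_on w {2..<m} \<and> 0 \<notin> w ` {2..<m}"

lemma ex_distinct_nonzero:
  assumes "m \<le> CARD('a::{field,finite}) + 1"
  shows "\<exists>w :: nat \<Rightarrow> 'a. distinct_nonzero w m"
proof -
  have "card {2..<m} \<le> card (UNIV - {0 :: 'a})"
    using assms by simp
  then obtain w :: "nat \<Rightarrow> 'a" where "w ` {2..<m} \<subseteq> UNIV - {0}" "inj_on w {2..<m}"
    using card_le_inj[of "{2..<m}" "UNIV - {0 :: 'a}"] by auto
  then show ?thesis
    unfolding distinct_nonzero_def by blast
qed

text \<open>Different points of the projective line: any two columns of the parity check matrix are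
  independent.\<close>

lemma chk_det_nonzero:
  assumes w: "distinct_nonzero w m" and p: "p < m" "p' < m" "p \<noteq> p'"
  shows "chk_det w p p' \<noteq> 0"
proof -
  have "w i \<noteq> 0" if "i < m" "i \<noteq> 0" "i \<noteq> 1" for i
  proof -
    have "i \<in> {2..<m}"
      using that by simp
    then show ?thesis
      using w unfolding distinct_nonzero_def by (metis image_eqI)
  qed
  moreover have "w p \<noteq> w p'" if "p \<noteq> 0" "p \<noteq> 1" "p' \<noteq> 0" "p' \<noteq> 1"
  proof -
    have "p \<in> {2..<m}" "p' \<in> {2..<m}"
      using that p by simp_all
    then show ?thesis
      using w p(3) unfolding distinct_nonzero_def inj_on_def by blast
  qed
  ultimately show ?thesis
    using p by (auto simp: chk_det_def chk0_def chk1_def)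
qed

text \<open>A dependency between at most two columns is trivial. \<open>a\<close> and
  \<open>b\<close> range over all naturals, possibly equal or beyond the block, so callers may pass
  dummy positions.\<close>

lemma chk_sums_zero_imp_zero:
  fixes f :: "nat \<Rightarrow> 'a::field"
  assumes w: "distinct_nonzero w m"
    and 0: "(\<Sum>p<m. chk0 p * f p) = 0" "(\<Sum>p<m. chk1 w p * f p) = 0"
    and supp: "\<And>p. p < m \<Longrightarrow> p \<noteq> a \<Longrightarrow> p \<noteq> b \<Longrightarrow> f p = 0"
    and "p < m"
  shows "f p = 0"
proof -
  text \<open>Eliminating \<open>a\<close> from the two equations isolates \<open>b\<close>.\<close>
  have elim: "f b = 0" if supp: "\<And>p. p < m \<Longrightarrow> p \<noteq> a \<Longrightarrow> p \<noteq> b \<Longrightarrow> f p = 0"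
    and ab: "a < m" "b < m" "a \<noteq> b" for a b
  proof -
    have "0 = chk0 a * (\<Sum>p<m. chk1 w p * f p) - chk1 w a * (\<Sum>p<m. chk0 p * f p)"
      using 0 by simp
    also have "\<dots> = (\<Sum>p<m. chk_det w a p * f p)"
      by (simp add: chk_det_def sum_distrib_left sum_subtractf[symmetric] algebra_simps)
    also have "\<dots> = (\<Sum>p\<in>{b}. chk_det w a p * f p)"
    proof (rule sum.mono_neutral_right)
      show "\<forall>p\<in>{..<m} - {b}. chk_det w a p * f p = 0"
        using supp by (metis DiffE chk_det_def diff_self insertI1 lessThan_iff mult_eq_0_iff)
    qed (use ab in auto)
    finally show ?thesis
      using chk_det_nonzero[OF w ab] by simp
  qed
  show ?thesis
  proof (rule ccontr)
    assume "f p \<noteq> 0"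
    then have "p = a \<or> p = b"
      using supp \<open>p < m\<close> by blast
    \<comment> \<open>\<open>c\<close> is the other one of \<open>a\<close> and
      \<open>b\<close>.\<close>
    then obtain c where c: "\<And>p'. p' < m \<Longrightarrow> p' \<noteq> c \<Longrightarrow> p' \<noteq> p \<Longrightarrow> f p' = 0"
      using supp by metis
    show False
    proof (cases "c < m \<and> c \<noteq> p")
      case True
      then show False
        using elim[of c p] c \<open>p < m\<close> \<open>f p \<noteq> 0\<close> by blast
    next
      case False
      \<comment> \<open>Only position \<open>p\<close> is left, and a single column is never
        zero.\<close>
      then have only: "f p' = 0" if "p' < m" "p' \<noteq> p" for p'
        using c that by metis
      have "chk0 p * f p = (\<Sum>p<m. chk0 p * f p)" "chk1 w p * f p = (\<Sum>p<m. chk1 w p * f p)"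
        using \<open>p < m\<close> only by (subst sum.remove[of _ p]; simp)+
      then have "chk0 p = (0::'a)" "chk1 w p = 0"
        using 0 \<open>f p \<noteq> 0\<close> by simp_all
      then show False
        by (auto simp: chk0_def chk1_def split: if_splits)
    qed
  qed
qed

lemma subspace_block_code: "word.subspace (block_code w m n)"
proof (rule word.subspaceI)
  show "0 \<in> block_code w m n"
    by (simp add: block_code_def words_def)
next
  fix x y :: "nat \<Rightarrow> 'a"
  assume "x \<in> block_code w m n" "y \<in> block_code w m n"
  then show "x + y \<in> block_code w m n"
    by (simp add: block_code_def words_def distrib_left sum.distrib)
next
  fix c and x :: "nat \<Rightarrow> 'a"
  assume x: "x \<in> block_code w m n"
  have "(\<Sum>p<m. a p * (c * x (g p))) = c * (\<Sum>p<m. a p * x (g p))" for a :: "nat \<Rightarrow> 'a" and g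
    by (simp add: sum_distrib_left mult.left_commute)
  then show "word_scale c x \<in> block_code w m n"
    using x by (simp add: block_code_def words_def word_scale_def)
qed

definition block :: "nat \<Rightarrow> nat \<Rightarrow> nat set" where
  "block m b = (\<lambda>p. Suc (b * m + p)) ` {..<m}"

text \<open>The distance of the MDS code holds in each block separately, which serves both the
  locality and the global minimum distance.\<close>

lemma card_block_support_ge_3:
  fixes x :: "nat \<Rightarrow> 'a::field"
  assumes w: "distinct_nonzero w m" and x: "x \<in> block_code w m n"
    and i: "i \<in> block m b" "x i \<noteq> 0"
  shows "3 \<le> card {j \<in> block m b. x j \<noteq> 0}"
proof (rule ccontr)
  let ?S = "{j \<in> block m b. x j \<noteq> 0}"
  assume "\<not> 3 \<le> card ?S"
  moreover have fin: "finite ?S"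
    by (simp add: block_def)
  ultimately have "card (?S - {i}) \<le> 1"
    using i by simp
  then have "\<forall>j\<in>?S - {i}. \<forall>j'\<in>?S - {i}. j = j'"
    unfolding One_nat_def card_le_Suc0_iff_eq[OF finite_Diff[OF fin]] .
  then obtain j where j: "?S - {i} \<subseteq> {j}"
    by (cases "?S - {i} = {}") blast+
  obtain p where p: "p < m" "i = Suc (b * m + p)"
    using i(1) by (auto simp: block_def)
  \<comment> \<open>If \<open>i\<close> is the only support position, \<open>j\<close> is arbitrary
    and the possibly truncated difference is a harmless dummy.\<close>
  have "x (Suc (b * m + p')) = 0" if "p' < m" "p' \<noteq> p" "p' \<noteq> j - Suc (b * m)" for p'
  proof -
    have "Suc (b * m + p') \<in> block m b" "Suc (b * m + p') \<noteq> i" "Suc (b * m + p') \<noteq> j"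
      using that p(2) by (auto simp: block_def)
    then show ?thesis
      using j by blast
  qed
  moreover have "(\<Sum>p<m. chk0 p * x (Suc (b * m + p))) = 0" "(\<Sum>p<m. chk1 w p * x (Suc (b * m + p))) = 0"
    using x by (auto simp: block_code_def)
  ultimately have "x (Suc (b * m + p)) = 0"
    using chk_sums_zero_imp_zero[OF w, of "\<lambda>p. x (Suc (b * m + p))"] p(1) by blast
  then show False
    using i(2) p(2) by simp
qed

lemma mem_block: "m > 0 \<Longrightarrow> i \<ge> 1 \<Longrightarrow> i \<in> block m ((i - 1) div m)"
  unfolding block_def by (rule image_eqI[of _ _ "(i - 1) mod m"]) simp_all

text \<open>The repair set of \<open>i\<close> is its block clipped to \<open>{1..n}\<close>.
  Codewords vanish beyond \<open>n\<close>, so clipping loses no weight.\<close>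

lemma block_code_is_LRC:
  assumes w: "distinct_nonzero w (r + 2)"
  shows "is_LRC n r 3 (block_code w (r + 2) n)"
  unfolding is_LRC_def
proof
  fix i assume i: "i \<in> {1..n}"
  let ?b = "(i - 1) div (r + 2)"
  let ?R = "block (r + 2) ?b \<inter> {1..n}"
  have "card ?R \<le> card (block (r + 2) ?b)"
    by (intro card_mono) (auto simp: block_def)
  also have "\<dots> \<le> card {..<r + 2}"
    unfolding block_def by (intro card_image_le) simp
  finally have "card ?R \<le> r + 3 - 1"
    by simp
  moreover have "i \<in> ?R"
    using i mem_block[of "r + 2" i] by simp
  moreover have "enat 3 \<le> min_distance (puncture (block_code w (r + 2) n) ?R)"
    unfolding enat_le_min_distance
  proof (intro ballI impI)
    fix y assume "y \<in> puncture (block_code w (r + 2) n) ?R" "y \<noteq> 0"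
    then obtain x where x: "x \<in> block_code w (r + 2) n" and y: "y = (\<lambda>i. if i \<in> ?R then x i else 0)"
      unfolding puncture_def by blast
    obtain j where "y j \<noteq> 0"
      using \<open>y \<noteq> 0\<close> by (auto simp: fun_eq_iff)
    then have j: "j \<in> block (r + 2) ?b" "x j \<noteq> 0"
      using y by (auto split: if_splits)
    have "{i. y i \<noteq> 0} = {j \<in> block (r + 2) ?b. x j \<noteq> 0}"
      using x unfolding y by (auto simp: block_code_def words_def)
    then show "3 \<le> weight y"
      using card_block_support_ge_3[OF w x j] by (simp add: weight_def)
  qed
  ultimately show "\<exists>R\<subseteq>{1..n}. i \<in> R \<and> card R \<le> r + 3 - 1 \<and>
      enat 3 \<le> min_distance (puncture (block_code w (r + 2) n) R)"
    by (intro exI[of _ ?R]) auto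
qed

lemma block_code_min_weight:
  assumes w: "distinct_nonzero w m" "m > 0" and x: "x \<in> block_code w m n" "x \<noteq> 0"
  shows "3 \<le> weight x"
proof -
  obtain i where i: "x i \<noteq> 0"
    using x(2) by (auto simp: fun_eq_iff)
  have supp: "{i. x i \<noteq> 0} \<subseteq> {1..n}"
    using x(1) by (auto simp: block_code_def words_def)
  then have "i \<ge> 1"
    using i by auto
  then have "3 \<le> card {j \<in> block m ((i - 1) div m). x j \<noteq> 0}"
    using card_block_support_ge_3[OF w(1) x(1) mem_block i] w(2) by simp
  also have "\<dots> \<le> weight x"
    unfolding weight_def using supp by (intro card_mono) (auto intro: finite_subset)
  finally show ?thesis .
qed

text \<open>By Cramer's rule, any three columns of the parity check matrix are linearly dependent.\<close>

lemma block_code_word_with_support: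
  fixes w :: "nat \<Rightarrow> 'a::field"
  assumes w: "distinct_nonzero w m" and m: "m \<le> n"
    and abc: "a < m" "b < m" "c < m" "distinct [a, b, c]"
  obtains x where "x \<in> block_code w m n" "{i. x i \<noteq> 0} = {Suc a, Suc b, Suc c}"
proof -
  define f where "f p = (if p = a then chk_det w b c else if p = b then chk_det w c a
    else if p = c then chk_det w a b else 0)" for p
  define x where "x i = (if i = 0 then 0 else f (i - 1))" for i
  have f0: "f p = 0" if "p \<ge> m" for p
    using that abc by (auto simp: f_def)
  have sum_f: "(\<Sum>p<m. h p * f p) = h a * f a + h b * f b + h c * f c" for h :: "nat \<Rightarrow> 'a"
  proof -
    have "(\<Sum>p<m. h p * f p) = (\<Sum>p\<in>{a, b, c}. h p * f p)"
      by (rule sum.mono_neutral_right) (use abc in \<open>auto simp: f_def\<close>)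
    then show ?thesis
      using abc by simp
  qed
  have f_abc: "f a = chk_det w b c" "f b = chk_det w c a" "f c = chk_det w a b"
    using abc by (auto simp: f_def)
  have "(\<Sum>p<m. chk0 p * f p) = 0" "(\<Sum>p<m. chk1 w p * f p) = 0"
    unfolding sum_f f_abc by (simp_all add: chk_det_def algebra_simps)
  \<comment> \<open>The word lives in block 0; the checks of all other blocks only see
    zeros.\<close>
  moreover have "(\<Sum>p<m. h p * x (Suc (b * m + p))) = (if b = 0 then \<Sum>p<m. h p * f p else 0)"
    for h :: "nat \<Rightarrow> 'a" and b
    by (cases b) (simp_all add: x_def f0)
  ultimately have "x \<in> block_code w m n"
    using f0 m by (auto simp: block_code_def words_def x_def not_le)
  moreover have "{i. x i \<noteq> 0} = {Suc a, Suc b, Suc c}"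
  proof -
    have "f p \<noteq> 0 \<longleftrightarrow> p \<in> {a, b, c}" for p
      using chk_det_nonzero[OF w] abc by (auto simp: f_def)
    then have "x i \<noteq> 0 \<longleftrightarrow> i \<in> {Suc a, Suc b, Suc c}" for i
      by (cases i) (simp_all add: x_def)
    then show ?thesis
      by blast
  qed
  ultimately show ?thesis
    by (rule that)
qed

section \<open>Optimal locality, minimum distance and dimension of the block code\<close>

text \<open>\<open>r + 2 \<le> n\<close> makes the first block full. A smaller repair set of
  coordinate 1 misses some \<open>j\<close> there, and a word of weight 3 through 1 and
  \<open>j\<close> punctures to weight at most 2 without vanishing.\<close>

lemma block_code_r_optimal:
  assumes w: "distinct_nonzero w (r + 2)" and n: "r + 2 \<le> n" and r: "r \<ge> 1"
  shows "r_optimal n r 3 (block_code w (r + 2) n)"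
  unfolding r_optimal_def
proof (intro allI impI notI)
  fix r' assume r': "1 \<le> r' \<and> r' < r" and "is_LRC n r' 3 (block_code w (r + 2) n)"
  moreover have "1 \<in> {1..n}"
    using n by simp
  ultimately obtain R where R: "R \<subseteq> {1..n}" "1 \<in> R" "card R \<le> r' + 3 - 1"
    "enat 3 \<le> min_distance (puncture (block_code w (r + 2) n) R)"
    unfolding is_LRC_def by meson
  have "\<not> {1..r + 2} \<subseteq> R"
  proof
    assume "{1..r + 2} \<subseteq> R"
    then have "card {1..r + 2} \<le> card R"
      using R(1) finite_subset by (intro card_mono) auto
    then show False
      using R(3) r' by simp
  qed
  then obtain j where j: "j \<in> {1..r + 2}" "j \<notin> R"
    by blast
  then have "j \<noteq> 1"
    using R(2) by blast
  \<comment> \<open>A third position in the block, counted from 0 and different from 0 and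
    \<open>j - 1\<close>; it fits because \<open>r \<ge> 1\<close>.\<close>
  define c :: nat where "c = (if j = 2 then 2 else 1)"
  have "0 < r + 2" "j - 1 < r + 2" "c < r + 2" "distinct [0, j - 1, c]"
    using r j(1) \<open>j \<noteq> 1\<close> by (auto simp: c_def)
  then obtain x where x: "x \<in> block_code w (r + 2) n" and supp: "{i. x i \<noteq> 0} = {Suc 0, Suc (j - 1), Suc c}"
    by (rule block_code_word_with_support[OF w n])
  let ?y = "\<lambda>i. if i \<in> R then x i else 0"
  have "x 1 \<noteq> 0"
    using supp by auto
  then have "?y \<noteq> 0"
    using R(2) by (auto simp: fun_eq_iff)
  moreover have "?y \<in> puncture (block_code w (r + 2) n) R"
    using x unfolding puncture_def by blast
  ultimately have "3 \<le> weight ?y"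
    using R(4) unfolding enat_le_min_distance by blast
  moreover have "weight ?y \<le> card {Suc 0, Suc c}"
    unfolding weight_def using supp j by (intro card_mono) auto
  moreover have "card {Suc 0, Suc c} \<le> 2"
    by (simp add: card_insert_if)
  ultimately show False
    by simp
qed

lemma block_code_min_distance:
  fixes w :: "nat \<Rightarrow> 'a::{field,finite}"
  assumes w: "distinct_nonzero w m" and m: "3 \<le> m" "m \<le> n"
  shows "min_distance (block_code w m n) = enat 3"
proof (rule antisym)
  obtain x where x: "x \<in> block_code w m n" "{i. x i \<noteq> 0} = {Suc 0, Suc 1, Suc 2}"
    using block_code_word_with_support[OF w m(2), of 0 1 2] m(1) by auto
  have "x 1 \<noteq> 0"
    using x(2) by auto
  then have "x \<noteq> 0"
    by auto
  moreover have "weight x = 3"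
    unfolding weight_def x(2) by simp
  ultimately show "min_distance (block_code w m n) \<le> enat 3"
    unfolding min_distance_def using x(1) by (metis DiffI INF_lower singletonD)
  show "enat 3 \<le> min_distance (block_code w m n)"
    using block_code_min_weight[OF w] m(1) by (simp add: enat_le_min_distance)
qed

text \<open>Systematic encoding: projection to the information positions \<open>J\<close> is a
  bijection onto \<open>words J\<close>.\<close>

lemma dim_block_code:
  fixes w :: "nat \<Rightarrow> 'a::{field,finite}"
  assumes w: "distinct_nonzero w m" and t: "t + 2 \<le> m" and n: "n = l * m - t"
  shows "word.dim (block_code w m n) = n - 2 * l"
proof -
  let ?C = "block_code w m n"
  \<comment> \<open>\<open>K\<close> collects the two check positions of each of the
    \<open>l\<close> blocks.\<close>
  define K where "K = (\<lambda>(b, p). Suc (b * m + p)) ` ({..<l} \<times> {..<2::nat})"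
  define J where "J = {1..n} - K"
  have inj: "b * m + p = b' * m + p' \<longleftrightarrow> b = b' \<and> p = p'" if "p < m" "p' < m" for b p b' p'
    using that by (metis div_mult_self3 div_less mod_mult_self3 mod_less add_0_right not_less_zero)
  have K: "K \<subseteq> {1..n}"
  proof -
    \<comment> \<open>The cut removes \<open>t \<le> m - 2\<close> final positions, so the last
      block keeps both check positions.\<close>
    have "Suc (b * m + p) \<le> n" if "b < l" "p < 2" for b p
    proof -
      have "b * m + m \<le> l * m"
        using mult_le_mono1[of "Suc b" l m] that(1) by simp
      then show ?thesis
        using that(2) t n by linarith
    qed
    then show ?thesis
      by (auto simp: K_def)
  qed
  have mem_K: "Suc (b * m + p) \<in> K \<longleftrightarrow> b < l \<and> p < 2" if "p < m" for b p
    using that t by (auto simp: K_def inj)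
  have "card K = l * 2"
    unfolding K_def using t by (subst card_image) (auto intro!: inj_onI simp: inj card_cartesian_product)
  then have cardJ: "card J = n - 2 * l"
    using K by (simp add: J_def card_Diff_subset finite_subset)
  have le_l: "b < l" if "Suc (b * m + p) \<le> n" for b p
  proof (rule ccontr)
    assume "\<not> b < l"
    then have "l * m \<le> b * m"
      by simp
    then show False
      using that n by linarith
  qed
  let ?\<pi> = "\<lambda>x i. if i \<in> J then x i else (0::'a)"
  have "inj_on ?\<pi> ?C"
  proof (rule inj_onI)
    fix x y assume x: "x \<in> ?C" "y \<in> ?C" and eq: "?\<pi> x = ?\<pi> y"
    have d: "x - y \<in> ?C"
      using word.subspace_diff[OF subspace_block_code x] .
    have "(x - y) i = 0" for i
    proof (cases "i \<in> {1..n}")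
      case True
      define b p where "b = (i - 1) div m" and "p = (i - 1) mod m"
      have i: "i = Suc (b * m + p)" "p < m"
        using True t by (simp_all add: b_def p_def)
      \<comment> \<open>Agreement on \<open>J\<close> leaves only positions 0 and 1 of each block,
        whose two columns are independent.\<close>
      have "(x - y) (Suc (b * m + p')) = 0" if "p' < m" "p' \<noteq> 0" "p' \<noteq> 1" for p'
      proof (cases "Suc (b * m + p') \<in> {1..n}")
        case True
        then have "Suc (b * m + p') \<in> J"
          using mem_K[OF \<open>p' < m\<close>] that by (auto simp: J_def)
        then show ?thesis
          using fun_cong[OF eq, of "Suc (b * m + p')"] by simp
      next
        case False
        then show ?thesis
          using d by (simp add: block_code_def words_def)
      qed
      moreover have "(\<Sum>p<m. chk0 p * (x - y) (Suc (b * m + p))) = 0"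
        "(\<Sum>p<m. chk1 w p * (x - y) (Suc (b * m + p))) = 0"
        using d by (auto simp only: block_code_def mem_Collect_eq)
      ultimately show ?thesis
        using chk_sums_zero_imp_zero[OF w, of "\<lambda>p. (x - y) (Suc (b * m + p))" 0 1 p] i by blast
    next
      case False
      then show ?thesis
        using d by (auto simp: block_code_def words_def)
    qed
    then show "x = y"
      by (auto simp: fun_eq_iff)
  qed
  moreover have "?\<pi> ` ?C = words J"
  proof
    show "?\<pi> ` ?C \<subseteq> words J"
      by (auto simp: words_def)
    show "words J \<subseteq> ?\<pi> ` ?C"
    proof
      fix y :: "nat \<Rightarrow> 'a" assume y: "y \<in> words J"
      \<comment> \<open>The check symbols: as the columns at 0 and 1 are unit vectors, each check
        equation is solved for one of them.\<close>
      define S where "S h b = - (\<Sum>p\<in>{2..<m}. h p * y (Suc (b * m + p)))" for h b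
      define x where "x i = (if i \<in> K then if (i - 1) mod m = 0 then S chk0 ((i - 1) div m)
        else S (chk1 w) ((i - 1) div m) else y i)" for i
      have split: "{..<m} = insert 0 (insert 1 {2..<m})"
        using t by auto
      have y0: "y i = 0" if "i \<notin> J" for i
        using y that by (simp add: words_def)
      have xp: "x (Suc (b * m + p)) = y (Suc (b * m + p))" if "p \<in> {2..<m}" for b p
        using that mem_K[of p b] by (simp add: x_def)
      have "x (Suc (b * m + 0)) = S chk0 b \<and> x (Suc (b * m + 1)) = S (chk1 w) b" for b
      proof (cases "b < l")
        case True
        have "(b * m + 1) div m = b" "(b * m + 1) mod m = 1"
          using t div_mult_self3[where a = 1 and b = m and c = b] mod_mult_self3[of b m 1] by simp_all
        then show ?thesis
          using True mem_K[of 0 b] mem_K[of 1 b] t by (simp add: x_def)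
      next
        case False
        \<comment> \<open>Blocks from \<open>l\<close> on lie beyond \<open>n\<close>, where
          \<open>x\<close> and \<open>y\<close> are both zero.\<close>
        then have "Suc (b * m + p) \<notin> {1..n}" for p
          using le_l by auto
        then have "y (Suc (b * m + p)) = 0" for p
          by (intro y0) (simp add: J_def)
        moreover have "Suc (b * m + 0) \<notin> K" "Suc (b * m + 1) \<notin> K"
          using mem_K[of 0 b] mem_K[of 1 b] False t by simp_all
        ultimately show ?thesis
          using \<open>\<And>p. y (Suc (b * m + p)) = 0\<close> by (simp only: x_def S_def) simp
      qed
      then have "(\<Sum>p<m. chk0 p * x (Suc (b * m + p))) = 0 \<and>
          (\<Sum>p<m. chk1 w p * x (Suc (b * m + p))) = 0" for b
        unfolding split by (simp add: xp S_def chk0_def chk1_def)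
      moreover have "x \<in> words {1..n}"
        using K y0 by (auto simp: words_def x_def J_def)
      ultimately have "x \<in> ?C"
        by (simp add: block_code_def)
      moreover have "?\<pi> x = y"
        using y0 by (auto simp: fun_eq_iff x_def J_def)
      ultimately show "y \<in> ?\<pi> ` ?C"
        by blast
    qed
  qed
  ultimately have "card ?C = card (words J :: (nat \<Rightarrow> 'a) set)"
    by (metis card_image)
  also have "\<dots> = CARD('a) ^ (n - 2 * l)"
    using cardJ by (simp add: J_def card_words)
  finally have "CARD('a) ^ word.dim ?C = CARD('a) ^ (n - 2 * l)"
    using word.card_subspace[OF subspace_block_code, of w m n]
      finite_subset[OF _ finite_words[of "{1..n}"], of ?C] by (auto simp: block_code_def)
  moreover have "CARD('a) > 1"
    using card_mono[of UNIV "{0, 1 :: 'a}"] by simp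
  ultimately show ?thesis
    by (simp add: power_inject_exp)
qed

section \<open>The characterisation for field size above 2, and its quaternary case\<close>

text \<open>\<open>r < q\<close> says that the block length \<open>r + 2\<close> is at most
  \<open>q + 1\<close>, the number of points of the projective line that can serve as
  columns.\<close>

lemma ex_optimal_LRC_3_iff:
  assumes q: "CARD('a::{field,finite}) > 2" and r: "r \<ge> 1" and k: "k > r"
  shows "(\<exists>C :: (nat \<Rightarrow> 'a) set. optimal_LRC n k 3 r 3 C) \<longleftrightarrow>
    r < CARD('a) \<and> (\<exists>l t. l \<ge> 2 \<and> t < r \<and> n = l * (r + 2) - t \<and> k = l * r - t)"
    (is "?L \<longleftrightarrow> ?R")
proof
  assume ?L
  then obtain C :: "(nat \<Rightarrow> 'a) set" where C: "optimal_LRC n k 3 r 3 C"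
    by blast
  then have "d_optimal n k 3 r 3"
    by (simp add: optimal_LRC_def)
  then show ?R
    using optimal_LRC_3_imp_small_locality[OF C q] d_optimal_3_3_iff[OF r k] by blast
next
  assume R: ?R
  then obtain l t where lt: "l \<ge> 2" "t < r" "n = l * (r + 2) - t" "k = l * r - t"
    by blast
  obtain w :: "nat \<Rightarrow> 'a" where w: "distinct_nonzero w (r + 2)"
    using ex_distinct_nonzero[where 'a = 'a, of "r + 2"] R by auto
  \<comment> \<open>With at least two blocks and fewer than \<open>r\<close> coordinates cut off,
    the first block stays full.\<close>
  have "2 * (r + 2) \<le> l * (r + 2)"
    using lt(1) by (simp only: mult_le_mono1)
  moreover have "r + 2 \<le> N - t" if "2 * (r + 2) \<le> N" for N
    using that lt(2) by arith
  ultimately have n: "r + 2 \<le> n"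
    unfolding lt(3) by blast
  have nk: "n - 2 * l = k"
    using lt(3,4) by (simp add: algebra_simps)
  have "linear_code n k 3 (block_code w (r + 2) n)"
    unfolding linear_code_def
  proof (intro conjI)
    show "block_code w (r + 2) n \<subseteq> words {1..n}"
      by (auto simp: block_code_def)
    show "word.subspace (block_code w (r + 2) n)"
      by (rule subspace_block_code)
    show "word.dim (block_code w (r + 2) n) = k"
      using dim_block_code[OF w _ lt(3)] lt(2) nk by simp
    show "min_distance (block_code w (r + 2) n) = enat 3"
      using block_code_min_distance[OF w _ n] r by simp
  qed
  then have "optimal_LRC n k 3 r 3 (block_code w (r + 2) n)"
    unfolding optimal_LRC_def
    using block_code_is_LRC[OF w] block_code_r_optimal[OF w n r] d_optimal_3_3_iff[OF r k] R r k by simp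
  then show ?L
    by blast
qed

theorem mainTheorem1:
  fixes n k r \<delta> :: nat
  assumes "CARD('a::{field,finite}) = 4"
    and "\<delta> > 2" and "k > r" and "r \<ge> 1"
  shows "(\<exists>C :: (nat \<Rightarrow> 'a) set. optimal_LRC n k 3 r \<delta> C) \<longleftrightarrow>
    \<delta> = 3 \<and> (\<exists>l::nat. l \<ge> 2 \<and>
      ((r = 3 \<and> n = 5 * l - 1 \<and> k = 3 * l - 1) \<or>
       (r = 2 \<and> n = 4 * l - 1 \<and> k = 2 * l - 1) \<or>
       (r = 3 \<and> n = 5 * l - 2 \<and> k = 3 * l - 2) \<or>
       (1 \<le> r \<and> r \<le> 3 \<and> n = l * (r + 2) \<and> k = r * l)))"
    (is "?L \<longleftrightarrow> \<delta> = 3 \<and> (\<exists>l. ?P l)")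
proof (cases "\<delta> = 3")
  case False
  \<comment> \<open>Optimality includes \<open>d \<ge> \<delta>\<close>, so \<open>d = 3\<close> and
    \<open>\<delta> > 2\<close> leave only \<open>\<delta> = 3\<close>.\<close>
  then show ?thesis
    using assms(2) by (auto simp: optimal_LRC_def)
next
  case True
  have ex_less: "(\<exists>t<1. Q t) \<longleftrightarrow> Q 0" "(\<exists>t<2. Q t) \<longleftrightarrow> Q 0 \<or> Q 1"
    "(\<exists>t<3. Q t) \<longleftrightarrow> Q 0 \<or> Q 1 \<or> Q 2" for Q :: "nat \<Rightarrow> bool"
    by (auto simp: numeral_eq_Suc less_Suc_eq)
  \<comment> \<open>\<open>t = 0\<close> gives the last disjunct; the pairs \<open>(r, t)\<close>
    equal to \<open>(3, 1)\<close>, \<open>(2, 1)\<close> and \<open>(3, 2)\<close> give the first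
    three in order.\<close>
  have P: "?P l \<longleftrightarrow> r < 4 \<and> l \<ge> 2 \<and> (\<exists>t<r. n = l * (r + 2) - t \<and> k = l * r - t)" for l
  proof -
    consider "r = 1" | "r = 2" | "r = 3" | "r \<ge> 4"
      using assms(4) by linarith
    then show ?thesis
    proof cases
      case 1
      then show ?thesis
        unfolding 1 ex_less by (simp add: mult.commute)
    next
      case 2
      then show ?thesis
        unfolding 2 ex_less by (simp add: mult.commute) blast
    next
      case 3
      then show ?thesis
        unfolding 3 ex_less by (simp add: mult.commute) blast
    next
      case 4
      then show ?thesis
        by simp
    qed
  qed
  have "CARD('a) > 2"
    using assms(1) by simp
  note iff = ex_optimal_LRC_3_iff[OF this assms(4,3), unfolded assms(1)]
  show ?thesis
    unfolding True iff P by blast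
qed

end
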